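(* Let $N\ge1$, let $W_0$ be an $N\times N$ nonnegative matrix without null rows and without null columns, and let $(W_t)_t$ be the normalized sequence generated from $W_0$ by a sequence of normalizing operators $(T^{(k_t)}_{l_t})_{t\ge1}$, where $k_t\in\{r,c\}$ and $l_t\in\{1,\ldots,N\}$. Let \[ \mathcal{K}_0=\{(k,l)\in\{r,c\}\times\{1,\ldots,N\}\colon k_t=k\text{ and }l_t=l\text{ for infinitely many }t\}. \] Then there exists a positive $\mathcal{K}_0$-diagonal for $W_0$ if and only if \[ (W_t)^{(k)}_l\longrightarrow 0\quad\text{as }t\to\infty,\qquad\text{for every }(k,l)\in\mathcal{K}_0 . \]
   Context: For a matrix $W$: $W^{(r)}_i=\sum_j W_{ij}-1$ and $W^{(c)}_j=\sum_i W_{ij}-1$. Normalizing operators, acting on $N\times N$ nonnegative matrices without null rows or columns: $T^{(r)}_{l}(W)$ is the matrix obtained from $W$ by dividing each entry of the $l$-th row by the $l$-th row sum $\sum_k W_{lk}$, leaving all other entries unchanged; $T^{(c)}_{l}(W)$ is obtained from $W$ by dividing each entry of the $l$-th column by the $l$-th column sum $\sum_k W_{kl}$, leaving all other entries unchanged. The normalized sequence generated by $(T^{(k_t)}_{l_t})_{t\ge1}$ from $W_0$ is defined inductively by $W_t=T^{(k_t)}_{l_t}(W_{t-1})$, $t\ge1$. The sequence $(k_t,l_t)_t$ is arbitrary. For $\mathcal{K}\subseteq\{r,c\}\times\{1,\ldots,N\}$, a $\mathcal{K}$-diagonal is a set $D\subseteq\{1,\ldots,N\}^2$ of matrix positions such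 that for every $(r,l)\in\mathcal{K}$ exactly one element of $D$ lies in the $l$-th row, and for every $(c,l)\in\mathcal{K}$ exactly one element of $D$ lies in the $l$-th column (no constraint for rows and columns not in $\mathcal{K}$). A $\mathcal{K}$-diagonal $D$ is positive for $W$ if $W_{ij}>0$ for all $(i,j)\in D$. *)

theory Defs
  imports "HOL-Analysis.Analysis"
begin

text \<open>
  Square matrices of size \<open>N \<ge> 1\<close> are modelled by the type \<open>real ^ 'n ^ 'n\<close> with
  \<open>N = CARD('n)\<close>; \<open>W $ i $ j\<close> is the entry in row \<open>i\<close> and column \<open>j\<close>.
\<close>

datatype line_kind = Row | Col

fun line_sum :: "line_kind \<Rightarrow> 'n::finite \<Rightarrow> real ^ 'n ^ 'n \<Rightarrow> real" where
  "line_sum Row l W = (\<Sum>j\<in>UNIV. W $ l $ j)"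
| "line_sum Col l W = (\<Sum>i\<in>UNIV. W $ i $ l)"

text \<open>This is \<open>W\<^sup>(\<^sup>k\<^sup>)\<^sub>l\<close>.\<close>

definition line_excess :: "line_kind \<Rightarrow> 'n::finite \<Rightarrow> real ^ 'n ^ 'n \<Rightarrow> real" where
  "line_excess k l W = line_sum k l W - 1"

definition nonneg_matrix :: "real ^ 'n ^ 'n::finite \<Rightarrow> bool" where
  "nonneg_matrix W \<longleftrightarrow> (\<forall>i j. 0 \<le> W $ i $ j)"

definition no_null_lines :: "real ^ 'n ^ 'n::finite \<Rightarrow> bool" where
  "no_null_lines W \<longleftrightarrow> (\<forall>i. row i W \<noteq> 0) \<and> (\<forall>j. column j W \<noteq> 0)"

text \<open>
  The operators are only meant for nonnegative matrices without null rows or columns. They preserve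
  this class, so the convention \<open>x / 0 = 0\<close> plays no role for the sequences generated from it.
\<close>

fun normalize_line :: "line_kind \<Rightarrow> 'n::finite \<Rightarrow> real ^ 'n ^ 'n \<Rightarrow> real ^ 'n ^ 'n" where
  "normalize_line Row l W =
     (\<chi> i j. if i = l then W $ i $ j / line_sum Row l W else W $ i $ j)"
| "normalize_line Col l W =
     (\<chi> i j. if j = l then W $ i $ j / line_sum Col l W else W $ i $ j)"

text \<open>Operators are indexed by \<open>t \<ge> 1\<close>; the values \<open>k 0\<close> and \<open>l 0\<close> are never used.\<close>

primrec normalized_seq ::
  "(nat \<Rightarrow> line_kind) \<Rightarrow> (nat \<Rightarrow> 'n::finite) \<Rightarrow> real ^ 'n ^ 'n \<Rightarrow> nat \<Rightarrow> real ^ 'n ^ 'n" where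
  "normalized_seq k l W0 0 = W0"
| "normalized_seq k l W0 (Suc t) =
     normalize_line (k (Suc t)) (l (Suc t)) (normalized_seq k l W0 t)"

definition recurrent_lines :: "(nat \<Rightarrow> line_kind) \<Rightarrow> (nat \<Rightarrow> 'n) \<Rightarrow> (line_kind \<times> 'n) set" where
  "recurrent_lines k l = {(a, b). infinite {t. 1 \<le> t \<and> k t = a \<and> l t = b}}"

definition is_diagonal :: "(line_kind \<times> 'n) set \<Rightarrow> ('n \<times> 'n) set \<Rightarrow> bool" where
  "is_diagonal K D \<longleftrightarrow>
     (\<forall>l. (Row, l) \<in> K \<longrightarrow> (\<exists>!p. p \<in> D \<and> fst p = l)) \<and>
     (\<forall>l. (Col, l) \<in> K \<longrightarrow> (\<exists>!p. p \<in> D \<and> snd p = l))"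

definition positive_on :: "real ^ 'n ^ 'n::finite \<Rightarrow> ('n \<times> 'n) set \<Rightarrow> bool" where
  "positive_on W D \<longleftrightarrow> (\<forall>(i, j)\<in>D. 0 < W $ i $ j)"

end

theory Submission
  imports Defs
begin

text \<open>
  A matrix is treated as a mass distribution on the set of positions, a row or column as a set of
  positions, and a normalizing step as the rescaling of such a set to mass \<open>1\<close>. Rescaling is exact
  coordinate descent for the relative entropy \<open>kl v w\<close> of a reference \<open>v\<close> that lives
  where \<open>w\<close> is positive and has mass \<open>1\<close> on the rescaled set: when the current mass there is \<open>s\<close>,
  the entropy drops by \<open>s - 1 - ln s \<ge> 0\<close>, the same for all such \<open>v\<close> (\<open>kl_rescale\<close>).

  Suppose that a positive diagonal \<open>D\<close> exists. Discard the steps up to the last normalization of a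
  line that is not recurrent. The indicator of \<open>D\<close> has mass \<open>1\<close> on every recurrent line, so the
  entropy relative to it decreases; hence the matrices stay bounded and the sums found just before
  each normalization tend to \<open>1\<close>. A limit point \<open>V\<close> then serves as a second reference. Close to
  \<open>V\<close> only lines with sum \<open>1\<close> in \<open>V\<close> can be normalized, and for these the entropy relative to \<open>V\<close>
  decreases too, so the sequence can never leave a neighbourhood of \<open>V\<close>. Therefore it converges to
  \<open>V\<close>, and all recurrent lines have sum \<open>1\<close> in \<open>V\<close> (\<open>rescaling_sequence_converges\<close>).

  Conversely, suppose that the recurrent line sums tend to \<open>1\<close>. Some late matrix, which has the same
  positive entries as the initial one, has all recurrent line sums close to \<open>1\<close>. Its recurrent lines
  index a symmetric square matrix with the same line sums, in which the mass on lines that are not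
  recurrent is moved to the diagonal (\<open>fold_matrix\<close>). Hall's theorem gives a permutation along
  positive entries of it, from which a diagonal is read off (\<open>diagonal_of_nearly_normalized\<close>).
\<close>

section \<open>Hall's theorem and nearly doubly stochastic matrices\<close>

text \<open>
  Hall's marriage theorem, proved after Halmos and Vaughan. If some proper nonempty \<open>J\<close> is tight,
  i.e. sees only \<open>card J\<close> values, the choice splits into one on \<open>J\<close> and one on its complement that
  avoids these values: what the complement loses in tests against \<open>J \<union> J'\<close> is exactly \<open>card J\<close>.
  If no \<open>J\<close> is tight, there is one unit of slack everywhere, so any single value can be spent.
\<close>

lemma hall_injective_choice:
  assumes "finite I" and "\<And>x. x \<in> I \<Longrightarrow> finite (A x)"
    and "\<And>J. J \<subseteq> I \<Longrightarrow> card J \<le> card (\<Union>x\<in>J. A x)"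
  shows "\<exists>f. inj_on f I \<and> (\<forall>x\<in>I. f x \<in> A x)"
  using assms
proof (induction "card I" arbitrary: I A rule: less_induct)
  case less
  note fin = less.prems(1) and finA = less.prems(2) and hall = less.prems(3)
  have finU: "finite (\<Union>x\<in>J. A x)" if "J \<subseteq> I" for J
    using that fin finA finite_subset by blast
  show ?case
  proof (cases "I = {}")
    case True
    then show ?thesis by simp
  next
    case False
    then obtain x where x: "x \<in> I" by blast
    show ?thesis
    proof (cases "\<exists>J. J \<subset> I \<and> J \<noteq> {} \<and> card (\<Union>x\<in>J. A x) \<le> card J")
      case True
      then obtain J where J: "J \<subset> I" "J \<noteq> {}" "card (\<Union>x\<in>J. A x) \<le> card J" by blast
      define U where "U = (\<Union>x\<in>J. A x)"
      have finJ: "finite J" using J fin finite_subset by blast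
      have "\<exists>f. inj_on f J \<and> (\<forall>x\<in>J. f x \<in> A x)"
        using J fin finA hall by (intro less.hyps psubset_card_mono) (auto intro: finite_subset)
      then obtain f where f: "inj_on f J" "\<And>x. x \<in> J \<Longrightarrow> f x \<in> A x" by blast
      have "\<exists>g. inj_on g (I - J) \<and> (\<forall>x\<in>I - J. g x \<in> A x - U)"
      proof (rule less.hyps)
        show "card (I - J) < card I"
          using J fin by (intro psubset_card_mono) auto
        fix J' assume J': "J' \<subseteq> I - J"
        have finJ': "finite J'" using J' fin finite_subset by blast
        have "(\<Union>x\<in>J'. A x - U) = (\<Union>x\<in>J \<union> J'. A x) - U" unfolding U_def by blast
        then have "card (\<Union>x\<in>J'. A x - U) = card (\<Union>x\<in>J \<union> J'. A x) - card U"
          using finU[of J] J unfolding U_def by (subst card_Diff_subset[symmetric]) auto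
        moreover have "card (J \<union> J') \<le> card (\<Union>x\<in>J \<union> J'. A x)" using hall J J' by blast
        moreover have "card (J \<union> J') = card J + card J'"
          using finJ finJ' J' by (intro card_Un_disjoint) auto
        ultimately show "card J' \<le> card (\<Union>x\<in>J'. A x - U)"
          using J(3) unfolding U_def by linarith
      qed (use fin finA in auto)
      then obtain g where g: "inj_on g (I - J)" "\<And>x. x \<in> I - J \<Longrightarrow> g x \<in> A x - U" by blast
      let ?h = "\<lambda>x. if x \<in> J then f x else g x"
      have fU: "f x \<in> U" if "x \<in> J" for x using f(2) that unfolding U_def by blast
      have "inj_on ?h J" using f(1) by (simp add: inj_on_def)
      moreover have "inj_on ?h (I - J)" using g(1) by (simp add: inj_on_def)
      moreover have "?h ` J \<inter> ?h ` (I - J) = {}" using fU g(2) by fastforce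
      ultimately have "inj_on ?h (J \<union> (I - J))" by (simp only: inj_on_Un) blast
      moreover have "J \<union> (I - J) = I" using J by blast
      ultimately have "inj_on ?h I" by simp
      moreover have "?h x \<in> A x" if "x \<in> I" for x using f(2) g(2) that by simp
      ultimately show ?thesis by blast
    next
      case False
      have "card {x} \<le> card (\<Union>x\<in>{x}. A x)" using hall x by blast
      then have "A x \<noteq> {}" by auto
      then obtain y where y: "y \<in> A x" by blast
      have "\<exists>g. inj_on g (I - {x}) \<and> (\<forall>z\<in>I - {x}. g z \<in> A z - {y})"
      proof (rule less.hyps)
        show "card (I - {x}) < card I"
          using x fin by (intro psubset_card_mono) auto
        fix J assume J: "J \<subseteq> I - {x}"
        show "card J \<le> card (\<Union>z\<in>J. A z - {y})"
        proof (cases "J = {}")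
          case False
          moreover have "J \<subset> I" using J x by blast
          ultimately have "card J < card (\<Union>z\<in>J. A z)"
            using \<open>\<not> (\<exists>J. _ J)\<close> by (meson not_le)
          also have "\<dots> \<le> Suc (card ((\<Union>z\<in>J. A z) - {y}))"
            using card_Suc_Diff1[OF finU[of J], of y] J
            by (cases "y \<in> (\<Union>z\<in>J. A z)") auto
          also have "(\<Union>z\<in>J. A z) - {y} = (\<Union>z\<in>J. A z - {y})" by blast
          finally show ?thesis by simp
        qed simp
      qed (use fin finA in auto)
      then obtain g where g: "inj_on g (I - {x})" "\<And>z. z \<in> I - {x} \<Longrightarrow> g z \<in> A z - {y}" by blast
      have "inj_on (g(x := y)) (insert x (I - {x}))"
        using g by (auto simp: inj_on_def)
      moreover have "insert x (I - {x}) = I" using x by blast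
      ultimately show ?thesis
        using g y by (intro exI[of _ "g(x := y)"]) auto
    qed
  qed
qed

text \<open>
  The combinatorial part of Birkhoff's theorem, with a margin: Hall's condition compares integers, so
  counting the mass of the rows in \<open>J\<close> against the mass of the columns they reach still decides it
  when all sums are only within \<open>e\<close> of \<open>1\<close>. This margin allows the theorem to be applied to a single
  late term of a sequence instead of to a limit.
\<close>

lemma nearly_stochastic_injective_choice:
  fixes M :: "'a \<Rightarrow> 'a \<Rightarrow> real"
  assumes "finite K" and nonneg: "\<And>x y. 0 \<le> M x y"
    and rows: "\<And>x. x \<in> K \<Longrightarrow> 1 - e \<le> (\<Sum>y\<in>K. M x y)"
    and cols: "\<And>y. y \<in> K \<Longrightarrow> (\<Sum>x\<in>K. M x y) \<le> 1 + e"
    and e: "0 \<le> e" "2 * real (card K) * e < 1"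
  shows "\<exists>f. inj_on f K \<and> (\<forall>x\<in>K. f x \<in> K \<and> 0 < M x (f x))"
proof -
  have "\<exists>f. inj_on f K \<and> (\<forall>x\<in>K. f x \<in> {y \<in> K. 0 < M x y})"
  proof (rule hall_injective_choice)
    fix J assume J: "J \<subseteq> K"
    define B where "B = (\<Union>x\<in>J. {y \<in> K. 0 < M x y})"
    have B: "B \<subseteq> K" "finite B" unfolding B_def using \<open>finite K\<close> by (auto intro: finite_subset[of _ K])
    have "real (card J) * (1 - e) = (\<Sum>x\<in>J. 1 - e)" by simp
    also have "\<dots> \<le> (\<Sum>x\<in>J. \<Sum>y\<in>K. M x y)" using rows J by (intro sum_mono) auto
    also have "\<dots> = (\<Sum>x\<in>J. \<Sum>y\<in>B. M x y)"
      using nonneg B \<open>finite K\<close>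
      by (intro sum.cong refl sum.mono_neutral_right) (auto simp: B_def less_eq_real_def)
    also have "\<dots> = (\<Sum>y\<in>B. \<Sum>x\<in>J. M x y)" by (rule sum.swap)
    also have "\<dots> \<le> (\<Sum>y\<in>B. \<Sum>x\<in>K. M x y)"
      using J \<open>finite K\<close> nonneg by (intro sum_mono sum_mono2) auto
    also have "\<dots> \<le> (\<Sum>y\<in>B. 1 + e)" using cols B by (intro sum_mono) auto
    also have "\<dots> = real (card B) * (1 + e)" by simp
    finally have le: "real (card J) * (1 - e) \<le> real (card B) * (1 + e)" .
    show "card J \<le> card (\<Union>x\<in>J. {y \<in> K. 0 < M x y})"
    proof (rule ccontr)
      assume "\<not> ?thesis"
      then have "real (card B) \<le> real (card J) - 1" unfolding B_def by linarith
      then have "real (card B) * (1 + e) \<le> (real (card J) - 1) * (1 + e)"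
        using e by (intro mult_right_mono) auto
      with le have "1 + e \<le> 2 * real (card J) * e" by (simp add: algebra_simps)
      also have "\<dots> \<le> 2 * real (card K) * e"
        using e card_mono[OF \<open>finite K\<close> J] by (intro mult_right_mono) auto
      finally show False using e by simp
    qed
  qed (use \<open>finite K\<close> in auto)
  then show ?thesis by auto
qed

section \<open>Relative entropy and rescaling\<close>

text \<open>
  A summand of the relative entropy of \<open>v\<close> with respect to \<open>w\<close>, in the form for unnormalized masses.
  The conventions \<open>x / 0 = 0\<close> and \<open>ln 0 = 0\<close> give it the correct value \<open>w\<close> at \<open>v = 0\<close>.
\<close>

definition kl_term :: "real \<Rightarrow> real \<Rightarrow> real" where
  "kl_term v w = v * ln (v / w) - v + w"

definition kl :: "('p::finite \<Rightarrow> real) \<Rightarrow> ('p \<Rightarrow> real) \<Rightarrow> real" where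
  "kl v w = (\<Sum>p\<in>UNIV. kl_term (v p) (w p))"

definition rescale :: "'p set \<Rightarrow> ('p \<Rightarrow> real) \<Rightarrow> 'p \<Rightarrow> real" where
  "rescale A w p = (if p \<in> A then w p / sum w A else w p)"

text \<open>
  Relative entropy dominates the squared Hellinger distance, by \<open>ln x \<le> x - 1\<close> at
  \<open>x = sqrt (w / v)\<close>. This single estimate yields nonnegativity, boundedness of sublevel sets in
  \<open>w\<close>, and the fact that small relative entropy forces \<open>w\<close> to be close to \<open>v\<close>.
\<close>

lemma kl_term_ge_sqrt:
  assumes "0 \<le> v" "0 \<le> w" "0 < v \<Longrightarrow> 0 < w"
  shows "(sqrt w - sqrt v)\<^sup>2 \<le> kl_term v w"
proof (cases "v = 0")
  case True
  then show ?thesis using assms by (simp add: kl_term_def)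
next
  case False
  then have v: "0 < v" and w: "0 < w" using assms by auto
  have "ln (sqrt (w / v)) \<le> sqrt (w / v) - 1" using v w by (intro ln_le_minus_one) simp
  then have "ln (w / v) \<le> 2 * sqrt (w / v) - 2" using v w by (simp add: ln_sqrt)
  moreover have "ln (v / w) = - ln (w / v)" using v w by (simp add: ln_div)
  ultimately have "2 - 2 * sqrt (w / v) \<le> ln (v / w)" by linarith
  then have "v * (2 - 2 * sqrt (w / v)) \<le> v * ln (v / w)" using v by simp
  moreover have "v * sqrt (w / v) = sqrt v * sqrt w"
    using v w by (simp add: real_sqrt_divide field_simps)
  ultimately show ?thesis
    using v w by (simp add: kl_term_def power2_diff algebra_simps)
qed

lemma kl_ge_sqrt:
  fixes v w :: "'p::finite \<Rightarrow> real"
  assumes "\<And>p. 0 \<le> v p" "\<And>p. 0 \<le> w p" "\<And>p. 0 < v p \<Longrightarrow> 0 < w p"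
  shows "(sqrt (w p) - sqrt (v p))\<^sup>2 \<le> kl v w"
proof -
  have *: "(sqrt (w q) - sqrt (v q))\<^sup>2 \<le> kl_term (v q) (w q)" for q
    using assms by (intro kl_term_ge_sqrt) auto
  have "kl_term (v p) (w p) \<le> kl v w"
    unfolding kl_def using * by (intro member_le_sum) (auto intro: order_trans[OF zero_le_power2])
  with * show ?thesis by (rule order_trans)
qed

lemma kl_term_nonneg:
  assumes "0 \<le> v" "0 \<le> w" "0 < v \<Longrightarrow> 0 < w"
  shows "0 \<le> kl_term v w"
  using kl_term_ge_sqrt[OF assms] by (auto intro: order_trans[OF zero_le_power2])

lemma kl_nonneg:
  fixes v w :: "'p::finite \<Rightarrow> real"
  assumes "\<And>p. 0 \<le> v p" "\<And>p. 0 \<le> w p" "\<And>p. 0 < v p \<Longrightarrow> 0 < w p"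
  shows "0 \<le> kl v w"
  unfolding kl_def using assms by (intro sum_nonneg kl_term_nonneg) auto

text \<open>
  The key identity. Dividing by \<open>s = sum w A\<close> on \<open>A\<close> changes the logarithmic part of \<open>kl v w\<close> by
  \<open>sum v A * ln s = ln s\<close> and the linear part by \<open>1 - s\<close>; the decrease \<open>s - 1 - ln s\<close> is itself
  an entropy term and does not depend on \<open>v\<close>.
\<close>

lemma kl_rescale:
  fixes v w :: "'p::finite \<Rightarrow> real"
  assumes "\<And>p. 0 \<le> v p" "\<And>p. 0 < v p \<Longrightarrow> 0 < w p" "sum v A = 1" and s: "0 < sum w A"
  shows "kl v (rescale A w) = kl v w - kl_term 1 (sum w A)"
proof -
  let ?s = "sum w A"
  have diff: "kl_term (v p) (rescale A w p) - kl_term (v p) (w p)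
      = (if p \<in> A then v p * ln ?s + w p / ?s - w p else 0)" for p
  proof (cases "0 < v p")
    case True
    moreover have "0 < w p" using True assms by blast
    ultimately show ?thesis using s
      by (simp add: kl_term_def rescale_def ln_div ln_mult algebra_simps)
  next
    case False
    then have "v p = 0" using assms(1)[of p] by simp
    then show ?thesis by (auto simp: kl_term_def rescale_def)
  qed
  have "kl v (rescale A w) - kl v w = (\<Sum>p\<in>UNIV. kl_term (v p) (rescale A w p) - kl_term (v p) (w p))"
    by (simp add: kl_def sum_subtractf)
  also have "\<dots> = (\<Sum>p\<in>A. v p * ln ?s + w p / ?s - w p)"
    unfolding diff by (simp add: sum.If_cases)
  also have "\<dots> = sum v A * ln ?s + ?s / ?s - ?s"
    by (simp only: sum.distrib sum_subtractf sum_distrib_right sum_divide_distrib)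
  also have "\<dots> = - kl_term 1 ?s"
    using s assms(3) by (simp add: kl_term_def ln_div)
  finally show ?thesis by simp
qed

section \<open>Convergence of rescaling sequences\<close>

lemma sum_pos_of_support:
  fixes v w :: "'p::finite \<Rightarrow> real"
  assumes "\<And>p. 0 \<le> v p" "\<And>p. 0 \<le> w p" "\<And>p. 0 < v p \<Longrightarrow> 0 < w p" "sum v A = 1"
  shows "0 < sum w A"
proof -
  obtain p where "p \<in> A" "v p \<noteq> 0"
    using assms(4) by (metis sum.neutral zero_neq_one)
  then have "0 < w p" using assms(1)[of p] assms(3) by (simp add: less_le)
  then show ?thesis using \<open>p \<in> A\<close> assms(2) by (intro sum_pos2[of _ p]) auto
qed

lemma sum_diff_le_kl:
  fixes v w :: "'p::finite \<Rightarrow> real"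
  assumes "\<And>p. 0 \<le> v p" "\<And>p. 0 \<le> w p" "\<And>p. 0 < v p \<Longrightarrow> 0 < w p"
    and M: "\<And>p. sqrt (v p) \<le> M" "\<And>p. sqrt (w p) \<le> M"
  shows "\<bar>sum w A - sum v A\<bar> \<le> real CARD('p) * (2 * M) * sqrt (kl v w)"
proof -
  have bound: "\<bar>w p - v p\<bar> \<le> 2 * M * sqrt (kl v w)" for p
  proof -
    have "\<bar>sqrt (w p) - sqrt (v p)\<bar> \<le> sqrt (kl v w)"
      using kl_ge_sqrt[of v w p] assms by (metis real_sqrt_abs real_sqrt_le_iff)
    moreover have "0 \<le> sqrt (w p) + sqrt (v p)" "sqrt (w p) + sqrt (v p) \<le> 2 * M"
      using assms(1,2)[of p] M[of p] by auto
    ultimately have "(sqrt (w p) + sqrt (v p)) * \<bar>sqrt (w p) - sqrt (v p)\<bar> \<le> 2 * M * sqrt (kl v w)"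
      by (intro mult_mono) auto
    moreover have "w p - v p = (sqrt (w p) + sqrt (v p)) * (sqrt (w p) - sqrt (v p))"
      using assms(1,2)[of p] by (simp add: algebra_simps)
    ultimately show ?thesis
      using \<open>0 \<le> sqrt (w p) + sqrt (v p)\<close> by (simp add: abs_mult)
  qed
  have "\<bar>sum w A - sum v A\<bar> \<le> (\<Sum>p\<in>A. \<bar>w p - v p\<bar>)"
    by (simp add: sum_subtractf[symmetric] sum_abs)
  also have "\<dots> \<le> (\<Sum>p\<in>UNIV. \<bar>w p - v p\<bar>)" by (intro sum_mono2) auto
  also have "\<dots> \<le> (\<Sum>p\<in>(UNIV :: 'p set). 2 * M * sqrt (kl v w))" by (intro sum_mono bound)
  finally show ?thesis by simp
qed

lemma rescale_support:
  fixes w :: "'p::finite \<Rightarrow> real"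
  assumes "\<And>p. 0 \<le> w p" "0 < sum w A"
  shows "0 \<le> rescale A w p" "0 < rescale A w p \<longleftrightarrow> 0 < w p"
  using assms by (auto simp: rescale_def zero_less_divide_iff less_le)

text \<open>
  The Hellinger bound \<open>(sqrt s - 1)\<^sup>2 \<le> s - 1 - ln s\<close> turns a vanishing decrease of the entropy into
  convergence of the masses.
\<close>

lemma tendsto_one_of_kl_term:
  assumes "(\<lambda>t. kl_term 1 (s t)) \<longlonglongrightarrow> 0" "\<And>t. 0 < s t"
  shows "s \<longlonglongrightarrow> 1"
proof -
  have "(\<lambda>t. (sqrt (s t) - 1)\<^sup>2) \<longlonglongrightarrow> 0"
    using assms(2) kl_term_ge_sqrt[of 1] less_imp_le
    by (intro tendsto_sandwich[OF _ _ tendsto_const assms(1)] always_eventually) auto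
  then have "(\<lambda>t. sqrt ((sqrt (s t) - 1)\<^sup>2)) \<longlonglongrightarrow> sqrt 0" by (rule tendsto_real_sqrt)
  then have "(\<lambda>t. sqrt (s t) - 1) \<longlonglongrightarrow> 0" by (simp add: tendsto_rabs_zero_iff)
  then have "(\<lambda>t. sqrt (s t)) \<longlonglongrightarrow> 1" using LIM_zero_iff by blast
  then have "(\<lambda>t. (sqrt (s t))\<^sup>2) \<longlonglongrightarrow> 1\<^sup>2" by (rule tendsto_power)
  moreover have "(sqrt (s t))\<^sup>2 = s t" for t using assms(2)[of t] by simp
  ultimately show ?thesis by simp
qed

lemma bounded_functions_convergent_subseq:
  fixes w :: "nat \<Rightarrow> 'p::finite \<Rightarrow> real"
  assumes "\<And>t p. \<bar>w t p\<bar> \<le> B"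
  obtains V r where "strict_mono (r :: nat \<Rightarrow> nat)" "\<And>p. (\<lambda>m. w (r m) p) \<longlonglongrightarrow> V p"
proof -
  let ?f = "\<lambda>t. \<chi> p. w t p"
  have "norm (?f t) \<le> real CARD('p) * B" for t
  proof -
    have "norm (?f t) \<le> (\<Sum>p\<in>UNIV. \<bar>w t p\<bar>)"
      using norm_le_l1_cart[of "?f t"] by simp
    also have "\<dots> \<le> (\<Sum>p\<in>(UNIV::'p set). B)" using assms by (intro sum_mono)
    finally show ?thesis by simp
  qed
  then have "bounded (range ?f)" by (auto simp: bounded_iff)
  from bounded_imp_convergent_subsequence[OF this]
  obtain x r where r: "strict_mono (r :: nat \<Rightarrow> nat)" and x: "(?f \<circ> r) \<longlonglongrightarrow> x" by blast
  have "(\<lambda>m. w (r m) p) \<longlonglongrightarrow> x $ p" for p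
    using tendsto_vec_nth[OF x, of p] by (simp add: o_def)
  with r show thesis by (rule that)
qed

text \<open>
  There are only finitely many sets \<open>A\<close>, so the sums that differ from \<open>1\<close> differ uniformly.
\<close>

lemma sums_bounded_away_from_one:
  fixes V :: "'p::finite \<Rightarrow> real"
  obtains \<delta> where "0 < \<delta>" "\<And>A. sum V A \<noteq> 1 \<Longrightarrow> \<delta> \<le> \<bar>sum V A - 1\<bar>"
proof -
  let ?S = "insert 1 ((\<lambda>A. \<bar>sum V A - 1\<bar>) ` {A. sum V A \<noteq> 1})"
  have "finite ?S" by simp
  then have "0 < Min ?S" "\<And>x. x \<in> ?S \<Longrightarrow> Min ?S \<le> x" by (subst Min_gr_iff) auto
  then show thesis by (intro that[of "Min ?S"]) auto
qed

lemma kl_tendsto_0: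
  fixes w :: "nat \<Rightarrow> 'p::finite \<Rightarrow> real"
  assumes "\<And>p. (\<lambda>m. w m p) \<longlonglongrightarrow> V p" "\<And>m p. 0 < V p \<Longrightarrow> 0 < w m p" "\<And>p. 0 \<le> V p"
  shows "(\<lambda>m. kl V (w m)) \<longlonglongrightarrow> 0"
proof -
  have "(\<lambda>m. kl_term (V p) (w m p)) \<longlonglongrightarrow> 0" for p
  proof (cases "V p = 0")
    case True
    then show ?thesis using assms(1)[of p] by (simp add: kl_term_def)
  next
    case False
    then have "0 < V p" using assms(3)[of p] by simp
    then have "(\<lambda>m. kl_term (V p) (w m p)) \<longlonglongrightarrow> V p * ln (V p / V p) - V p + V p"
      unfolding kl_term_def by (intro tendsto_intros assms(1)) auto
    then show ?thesis using False by simp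
  qed
  then have "(\<lambda>m. kl V (w m)) \<longlonglongrightarrow> (\<Sum>p\<in>(UNIV::'p set). 0)"
    unfolding kl_def by (intro tendsto_sum)
  then show ?thesis by simp
qed

text \<open>
  If some \<open>d\<close> supported in the support of \<open>w 0\<close> has mass \<open>1\<close> on every set used for rescaling, the
  sequence converges. Descent of \<open>kl d\<close> gives boundedness and shows that the masses seen at the
  rescaling steps tend to \<open>1\<close>. This says nothing about a set between two of its turns, which may be
  arbitrarily far apart, so the descent is used a second time with a limit point \<open>V\<close> in the place of
  \<open>d\<close>. Near \<open>V\<close>, the set rescaled next has mass nearly \<open>1\<close>, hence mass exactly \<open>1\<close> under \<open>V\<close>, hence
  \<open>kl V\<close> decreases and the sequence stays near \<open>V\<close>. Thus it is trapped, it converges to \<open>V\<close>, and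
  every set that still occurs has mass \<open>1\<close> under \<open>V\<close>.
\<close>

theorem rescaling_sequence_converges:
  fixes w :: "nat \<Rightarrow> 'p::finite \<Rightarrow> real" and L :: "nat \<Rightarrow> 'p set" and d :: "'p \<Rightarrow> real"
  assumes w0: "\<And>p. 0 \<le> w 0 p" and step: "\<And>t. w (Suc t) = rescale (L t) (w t)"
    and d: "\<And>p. 0 \<le> d p" "\<And>p. 0 < d p \<Longrightarrow> 0 < w 0 p" "\<And>t. sum d (L t) = 1"
  shows "\<exists>V. (\<forall>p. (\<lambda>t. w t p) \<longlonglongrightarrow> V p) \<and>
    (\<forall>A. infinite {t. L t = A} \<longrightarrow> sum V A = 1)"
proof -
  have "(\<forall>p. 0 \<le> w t p \<and> (0 < w t p \<longleftrightarrow> 0 < w 0 p)) \<and> 0 < sum (w t) (L t)" for t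
  proof (induction t)
    case 0
    show ?case using w0 sum_pos_of_support[of d "w 0"] d by auto
  next
    case (Suc t)
    have "0 \<le> w (Suc t) p \<and> (0 < w (Suc t) p \<longleftrightarrow> 0 < w 0 p)" for p
      using Suc rescale_support[of "w t" "L t" p] unfolding step[of t] by auto
    then show ?case using sum_pos_of_support[of d "w (Suc t)"] d by auto
  qed
  then have nonneg: "\<And>t p. 0 \<le> w t p" and supp: "\<And>t p. 0 < w t p \<longleftrightarrow> 0 < w 0 p"
    and s_pos: "\<And>t. 0 < sum (w t) (L t)" by blast+
  have supp_d: "0 < w t p" if "0 < d p" for t p
    using d(2)[OF that] supp[of t p] by simp
  have descent: "kl v (w (Suc t)) = kl v (w t) - kl_term 1 (sum (w t) (L t))"
    if "\<And>p. 0 \<le> v p" "\<And>p. 0 < v p \<Longrightarrow> 0 < w 0 p" "sum v (L t) = 1" for v t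
  proof -
    have "0 < w t p" if "0 < v p" for p using \<open>\<And>p. 0 < v p \<Longrightarrow> 0 < w 0 p\<close>[OF that] supp[of t p] by simp
    then show ?thesis unfolding step using that s_pos by (intro kl_rescale) blast+
  qed
  have gap: "0 \<le> kl_term 1 (sum (w t) (L t))" for t
    using s_pos[of t] by (intro kl_term_nonneg) auto

  have kl_d: "kl d (w t) = kl d (w 0) - (\<Sum>r<t. kl_term 1 (sum (w r) (L r)))" for t
    by (induction t) (use descent[of d] d in auto)
  have kl_d_nonneg: "0 \<le> kl d (w t)" for t
    using d nonneg supp_d by (intro kl_nonneg) auto
  have "summable (\<lambda>t. kl_term 1 (sum (w t) (L t)))"
  proof (rule bounded_imp_summable[OF gap])
    show "(\<Sum>r\<le>t. kl_term 1 (sum (w r) (L r))) \<le> kl d (w 0)" for t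
      using kl_d[of "Suc t"] kl_d_nonneg[of "Suc t"] unfolding lessThan_Suc_atMost by linarith
  qed
  then have "(\<lambda>t. kl_term 1 (sum (w t) (L t))) \<longlonglongrightarrow> 0" by (rule summable_LIMSEQ_zero)
  then have s_lim: "(\<lambda>t. sum (w t) (L t)) \<longlonglongrightarrow> 1" using s_pos by (rule tendsto_one_of_kl_term)

  \<comment> \<open>By \<open>kl_ge_sqrt\<close>, the square root of an entry moves at most \<open>sqrt (kl d (w 0))\<close> away from that of \<open>d\<close>.\<close>
  define M where "M = sqrt (kl d (w 0)) + (\<Sum>p\<in>UNIV. sqrt (d p))"
  have sqrt_le: "sqrt (w t p) \<le> M" for t p
  proof -
    have "(sqrt (w t p) - sqrt (d p))\<^sup>2 \<le> kl d (w t)"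
      using d nonneg supp_d by (intro kl_ge_sqrt) auto
    also have "\<dots> \<le> kl d (w 0)" using kl_d[of t] gap by (simp add: sum_nonneg)
    finally have "sqrt (w t p) - sqrt (d p) \<le> sqrt (kl d (w 0))" by (rule real_le_rsqrt)
    moreover have "sqrt (d p) \<le> (\<Sum>p\<in>UNIV. sqrt (d p))"
      using d by (intro member_le_sum) auto
    ultimately show ?thesis unfolding M_def by linarith
  qed
  have w_bound: "\<bar>w t p\<bar> \<le> M\<^sup>2" for t p
    using sqrt_le[of t p] nonneg[of t p] by (simp add: sqrt_le_D)
  obtain V r where r: "strict_mono (r :: nat \<Rightarrow> nat)"
    and V: "\<And>p. (\<lambda>m. w (r m) p) \<longlonglongrightarrow> V p"
    using bounded_functions_convergent_subseq[of w, OF w_bound] by blast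
  have V_nonneg: "0 \<le> V p" for p
    using V[of p] nonneg by (intro LIMSEQ_le_const) auto
  have V_supp: "0 < w 0 p" if "0 < V p" for p
  proof (rule ccontr)
    assume "\<not> 0 < w 0 p"
    then have "w t p = 0" for t using supp[of t p] nonneg[of t p] by simp
    then show False using V[of p] that by (simp add: LIMSEQ_const_iff)
  qed
  have supp_V: "0 < w t p" if "0 < V p" for t p
    using V_supp[OF that] supp[of t p] by simp
  have V_le: "sqrt (V p) \<le> M" for p
    using tendsto_real_sqrt[OF V[of p]] sqrt_le by (intro LIMSEQ_le_const2) auto
  have M0: "0 \<le> M" using sqrt_le[of 0] nonneg[of 0] by (meson order_trans real_sqrt_ge_zero)
  have kl_V_nonneg: "0 \<le> kl V (w t)" for t
    using V_nonneg nonneg supp_V by (intro kl_nonneg) auto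
  \<comment> \<open>The summand \<open>1\<close> makes \<open>C\<close> positive, so that it can be divided by.\<close>
  define C where "C = real CARD('p) * (2 * M) + 1"
  have C: "0 < C" unfolding C_def using M0 by (simp add: add_nonneg_pos)
  have close: "\<bar>sum (w t) A - sum V A\<bar> \<le> C * sqrt (kl V (w t))" for t A
  proof -
    have "\<bar>sum (w t) A - sum V A\<bar> \<le> real CARD('p) * (2 * M) * sqrt (kl V (w t))"
      using V_nonneg nonneg supp_V V_le sqrt_le by (intro sum_diff_le_kl) auto
    also have "\<dots> \<le> C * sqrt (kl V (w t))"
      unfolding C_def using kl_V_nonneg by (intro mult_right_mono) auto
    finally show ?thesis .
  qed
  have kl_sub: "(\<lambda>m. kl V (w (r m))) \<longlonglongrightarrow> 0"
    using V V_nonneg supp_V by (intro kl_tendsto_0) auto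

  obtain \<delta> where \<delta>: "0 < \<delta>" "\<And>A. sum V A \<noteq> 1 \<Longrightarrow> \<delta> \<le> \<bar>sum V A - 1\<bar>"
    using sums_bounded_away_from_one[of V] by blast
  obtain T1 where T1: "\<And>t. T1 \<le> t \<Longrightarrow> \<bar>sum (w t) (L t) - 1\<bar> < \<delta> / 2"
    using LIMSEQ_D[OF s_lim, of "\<delta> / 2"] \<delta>(1) by auto
  \<comment> \<open>Chosen so that entropy below \<open>\<eta>\<close> forces every sum to within \<open>\<delta> / 2\<close> of its value for \<open>V\<close>.\<close>
  define \<eta> where "\<eta> = (\<delta> / (2 * C))\<^sup>2"
  have \<eta>: "0 < \<eta>" unfolding \<eta>_def using \<delta> C by simp
  have on_V: "sum V (L t) = 1" if "T1 \<le> t" "kl V (w t) < \<eta>" for t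
  proof (rule ccontr)
    assume "sum V (L t) \<noteq> 1"
    then have "\<delta> \<le> \<bar>sum V (L t) - 1\<bar>" by (rule \<delta>(2))
    moreover have "C * sqrt (kl V (w t)) \<le> C * (\<delta> / (2 * C))"
      using that(2) C \<delta> unfolding \<eta>_def
      by (intro mult_left_mono real_le_lsqrt) (auto simp: kl_V_nonneg)
    moreover have "C * (\<delta> / (2 * C)) = \<delta> / 2" using C by simp
    ultimately show False using close[of t "L t"] T1[OF that(1)] by linarith
  qed
  have trapped: "kl V (w (t + n)) \<le> kl V (w t)" if t: "T1 \<le> t" "kl V (w t) < \<eta>" for t n
  proof (induction n)
    case (Suc n)
    then have "sum V (L (t + n)) = 1" using t by (intro on_V) auto
    then have "kl V (w (Suc (t + n))) \<le> kl V (w (t + n))"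
      using descent[of V "t + n"] V_nonneg V_supp gap[of "t + n"] by auto
    with Suc show ?case by simp
  qed simp
  \<comment> \<open>The subsequence enters every entropy neighbourhood of \<open>V\<close> at arbitrarily late times.\<close>
  have reach: "\<exists>t\<ge>T1. kl V (w t) < e" if "0 < e" for e
  proof -
    note pos = that
    obtain m where m: "\<And>n. n \<ge> m \<Longrightarrow> norm (kl V (w (r n)) - 0) < e"
      using LIMSEQ_D[OF kl_sub pos] by blast
    have "T1 \<le> r (max m T1)" using seq_suble[OF r, of "max m T1"] by simp
    moreover have "kl V (w (r (max m T1))) < e" using m[of "max m T1"] by auto
    ultimately show ?thesis by blast
  qed
  have "(\<lambda>t. kl V (w t)) \<longlonglongrightarrow> 0"
  proof (rule LIMSEQ_I)
    fix e :: real assume "0 < e"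
    then obtain t where t: "T1 \<le> t" "kl V (w t) < min e \<eta>" using reach[of "min e \<eta>"] \<eta> by auto
    have "norm (kl V (w n) - 0) < e" if "t \<le> n" for n
      using trapped[of t "n - t"] t that kl_V_nonneg[of n] by auto
    then show "\<exists>no. \<forall>n\<ge>no. norm (kl V (w n) - 0) < e" by blast
  qed
  then have bound_lim: "(\<lambda>t. C * sqrt (kl V (w t))) \<longlonglongrightarrow> 0"
    using tendsto_mult[OF tendsto_const tendsto_real_sqrt] by force
  have "(\<lambda>t. w t p) \<longlonglongrightarrow> V p" for p
  proof (rule LIM_zero_cancel, rule Lim_null_comparison[OF _ bound_lim])
    show "\<forall>\<^sub>F t in sequentially. norm (w t p - V p) \<le> C * sqrt (kl V (w t))"
      using close[of _ "{p}"] by simp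
  qed
  moreover have "sum V A = 1" if "infinite {t. L t = A}" for A
  proof -
    obtain t where t: "T1 \<le> t" "kl V (w t) < \<eta>" using reach[OF \<eta>] by auto
    have "\<exists>n\<ge>t. n \<in> {t. L t = A}"
      using that unfolding infinite_nat_iff_unbounded_le by (rule spec)
    then obtain n where n: "t \<le> n" "L n = A" by auto
    have "kl V (w n) \<le> kl V (w t)" using trapped[OF t, of "n - t"] n(1) by simp
    then show ?thesis using on_V[of n] t n by simp
  qed
  ultimately show ?thesis by blast
qed

section \<open>Normalized sequences of matrices\<close>

fun line_positions :: "line_kind \<Rightarrow> 'n \<Rightarrow> ('n \<times> 'n) set" where
  "line_positions Row l = {l} \<times> UNIV"
| "line_positions Col l = UNIV \<times> {l}"

definition entry :: "real ^ 'n ^ 'n \<Rightarrow> 'n \<times> 'n \<Rightarrow> real" where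
  "entry W p = W $ fst p $ snd p"

lemma line_sum_eq_sum_entry: "line_sum a b W = sum (entry W) (line_positions a b)"
proof (cases a)
  case Row
  have "sum (entry W) ({b} \<times> UNIV) = (\<Sum>i\<in>{b}. \<Sum>j\<in>UNIV. W $ i $ j)"
    unfolding sum.cartesian_product by (simp add: entry_def case_prod_beta)
  then show ?thesis using Row by simp
next
  case Col
  have "sum (entry W) (UNIV \<times> {b}) = (\<Sum>i\<in>UNIV. \<Sum>j\<in>{b}. W $ i $ j)"
    unfolding sum.cartesian_product by (simp add: entry_def case_prod_beta)
  then show ?thesis using Col by simp
qed

lemma entry_normalize_line: "entry (normalize_line a b W) = rescale (line_positions a b) (entry W)"
proof
  fix p :: "'a \<times> 'a"
  show "entry (normalize_line a b W) p = rescale (line_positions a b) (entry W) p"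
    unfolding rescale_def line_sum_eq_sum_entry[symmetric]
    by (cases a; cases p) (auto simp: entry_def)
qed

lemma normalized_seq_support:
  fixes W0 :: "real ^ 'n ^ 'n::finite"
  assumes "nonneg_matrix W0" "no_null_lines W0"
  shows "0 \<le> entry (normalized_seq k l W0 t) p
    \<and> (0 < entry (normalized_seq k l W0 t) p \<longleftrightarrow> 0 < entry W0 p)"
proof (induction t arbitrary: p)
  case 0
  show ?case using assms(1) by (simp add: nonneg_matrix_def entry_def)
next
  case (Suc t)
  let ?W = "normalized_seq k l W0 t"
  let ?A = "line_positions (k (Suc t)) (l (Suc t))"
  have "\<exists>q\<in>?A. entry W0 q \<noteq> 0"
    using assms(2)
    by (cases "k (Suc t)") (auto simp: no_null_lines_def entry_def row_def column_def vec_eq_iff)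
  then obtain q where "q \<in> ?A" "0 < entry ?W q"
    using Suc assms(1) by (force simp: nonneg_matrix_def entry_def less_le)
  then have "0 < sum (entry ?W) ?A" using Suc by (intro sum_pos2[of _ q]) auto
  then show ?case
    using rescale_support[of "entry ?W" ?A p] Suc by (simp add: entry_normalize_line)
qed

lemma finite_lines: "finite (K :: (line_kind \<times> 'n::finite) set)"
proof -
  have "UNIV = {Row, Col}" using line_kind.exhaust by auto
  then have "K \<subseteq> {Row, Col} \<times> (UNIV :: 'n set)" by auto
  then show ?thesis by (rule finite_subset) simp
qed

lemma recurrent_lines_eventually:
  fixes k :: "nat \<Rightarrow> line_kind" and l :: "nat \<Rightarrow> 'n::finite"
  obtains T where "\<And>t. T \<le> t \<Longrightarrow> (k (Suc t), l (Suc t)) \<in> recurrent_lines k l"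
proof -
  have "{t. 1 \<le> t \<and> (k t, l t) \<notin> recurrent_lines k l}
      = (\<Union>(a, b)\<in>- recurrent_lines k l. {t. 1 \<le> t \<and> k t = a \<and> l t = b})"
    by auto
  moreover have "finite (- recurrent_lines k l)" by (rule finite_lines)
  ultimately have "finite {t. 1 \<le> t \<and> (k t, l t) \<notin> recurrent_lines k l}"
    by (auto simp: recurrent_lines_def)
  then obtain T where T: "\<And>t. 1 \<le> t \<Longrightarrow> (k t, l t) \<notin> recurrent_lines k l \<Longrightarrow> t \<le> T"
    unfolding finite_nat_set_iff_bounded_le by blast
  have "(k (Suc t), l (Suc t)) \<in> recurrent_lines k l" if "T \<le> t" for t
    using T[of "Suc t"] that by fastforce
  then show thesis by (rule that)
qed

text \<open>
  The indicator function of a diagonal is the reference mass \<open>d\<close> needed for the convergence of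
  rescaling sequences.
\<close>

lemma diagonal_meets_line_once:
  fixes D :: "('n::finite \<times> 'n) set"
  assumes "is_diagonal K D" "(a, b) \<in> K"
  shows "sum (\<lambda>p. if p \<in> D then 1 else 0 :: real) (line_positions a b) = 1"
proof -
  have "\<exists>!p. p \<in> D \<and> p \<in> line_positions a b"
    using assms by (cases a) (auto simp: is_diagonal_def mem_Times_iff)
  then obtain p where "line_positions a b \<inter> D = {p}" by blast
  then show ?thesis by (simp add: sum.If_cases Int_commute)
qed

text \<open>
  From some time on only recurrent lines are normalized, and the tail of the sequence is a rescaling
  sequence whose reference mass is the indicator of \<open>D\<close>.
\<close>

lemma line_sums_converge:
  fixes W0 :: "real ^ 'n ^ 'n::finite"
  assumes W0: "nonneg_matrix W0" "no_null_lines W0"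
    and D: "is_diagonal (recurrent_lines k l) D" "positive_on W0 D"
    and ab: "(a, b) \<in> recurrent_lines k l"
  shows "(\<lambda>t. line_sum a b (normalized_seq k l W0 t)) \<longlonglongrightarrow> 1"
proof -
  obtain T where T: "\<And>t. T \<le> t \<Longrightarrow> (k (Suc t), l (Suc t)) \<in> recurrent_lines k l"
    using recurrent_lines_eventually[of k l] by blast
  define w where "w t = entry (normalized_seq k l W0 (T + t))" for t
  define L where "L t = line_positions (k (Suc (T + t))) (l (Suc (T + t)))" for t
  have "\<exists>V. (\<forall>p. (\<lambda>t. w t p) \<longlonglongrightarrow> V p) \<and> (\<forall>A. infinite {t. L t = A} \<longrightarrow> sum V A = 1)"
  proof (rule rescaling_sequence_converges[of w L "\<lambda>p. if p \<in> D then 1 else 0"])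
    show "0 \<le> w 0 p" for p
      using normalized_seq_support[OF W0] unfolding w_def by blast
    show "w (Suc t) = rescale (L t) (w t)" for t
      by (simp add: w_def L_def entry_normalize_line)
    show "(\<Sum>p\<in>L t. if p \<in> D then 1 else 0 :: real) = 1" for t
      unfolding L_def by (rule diagonal_meets_line_once[OF D(1)], rule T) simp
    show "0 < w 0 p" if "0 < (if p \<in> D then 1 else 0 :: real)" for p
    proof -
      have "0 < entry W0 p"
        using that D(2) by (cases p) (auto simp: positive_on_def entry_def split: if_splits)
      then show ?thesis using normalized_seq_support[OF W0] unfolding w_def by blast
    qed
  qed auto
  then obtain V where V: "\<And>p. (\<lambda>t. w t p) \<longlonglongrightarrow> V p"
    and V1: "\<And>A. infinite {t. L t = A} \<Longrightarrow> sum V A = 1" by blast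
  have "infinite {t. L t = line_positions a b}"
  proof -
    have "\<exists>n\<ge>m. L n = line_positions a b" for m
    proof -
      obtain t where t: "Suc (T + m) \<le> t" "k t = a" "l t = b"
        using ab unfolding recurrent_lines_def infinite_nat_iff_unbounded_le by blast
      then have "L (t - Suc T) = line_positions a b" "m \<le> t - Suc T" by (auto simp: L_def)
      then show ?thesis by blast
    qed
    then show ?thesis unfolding infinite_nat_iff_unbounded_le by blast
  qed
  then have "sum V (line_positions a b) = 1" by (rule V1)
  moreover have "(\<lambda>t. sum (w t) (line_positions a b)) \<longlonglongrightarrow> sum V (line_positions a b)"
    by (intro tendsto_sum V)
  ultimately have "(\<lambda>t. line_sum a b (normalized_seq k l W0 (t + T))) \<longlonglongrightarrow> 1"
    by (simp add: w_def line_sum_eq_sum_entry add.commute)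
  then show ?thesis by (rule LIMSEQ_offset)
qed

section \<open>Diagonals of nearly normalized matrices\<close>

text \<open>
  A matrix indexed on both sides by the lines in \<open>K\<close>. Off the diagonal it records the entries at
  which two lines of \<open>K\<close> cross; on the diagonal it records the mass of a line at its crossings with
  lines outside \<open>K\<close>. It is symmetric and its row sums are the line sums of \<open>W\<close>, so lines that are
  not constrained disappear and the problem becomes one about square, nearly doubly stochastic
  matrices.
\<close>

fun fold_matrix ::
  "(line_kind \<times> 'n::finite) set \<Rightarrow> real ^ 'n ^ 'n \<Rightarrow> line_kind \<times> 'n \<Rightarrow> line_kind \<times> 'n \<Rightarrow> real" where
  "fold_matrix K W (Row, i) (Col, j) = W $ i $ j"
| "fold_matrix K W (Col, j) (Row, i) = W $ i $ j"
| "fold_matrix K W (Row, i) (Row, i') =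
    (if i = i' then \<Sum>j | (Col, j) \<notin> K. W $ i $ j else 0)"
| "fold_matrix K W (Col, j) (Col, j') =
    (if j = j' then \<Sum>i | (Row, i) \<notin> K. W $ i $ j else 0)"

lemma fold_matrix_sym: "fold_matrix K W x y = fold_matrix K W y x"
  by (cases "(K, W, x, y)" rule: fold_matrix.cases) auto

lemma fold_matrix_sum:
  fixes W :: "real ^ 'n ^ 'n::finite"
  assumes "(a, b) \<in> K"
  shows "(\<Sum>y\<in>K. fold_matrix K W (a, b) y) = line_sum a b W"
proof -
  define R where "R = {i. (Row, i) \<in> K}"
  define C where "C = {j. (Col, j) \<in> K}"
  have K: "K = Pair Row ` R \<union> Pair Col ` C"
  proof (intro set_eqI)
    fix x :: "line_kind \<times> 'n"
    show "x \<in> K \<longleftrightarrow> x \<in> Pair Row ` R \<union> Pair Col ` C"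
      by (cases x; cases "fst x") (auto simp: R_def C_def)
  qed
  have split: "(\<Sum>y\<in>K. g y) = (\<Sum>i\<in>R. g (Row, i)) + (\<Sum>j\<in>C. g (Col, j))" for g :: "_ \<Rightarrow> real"
    unfolding K by (subst sum.union_disjoint) (auto simp: sum.reindex inj_on_def)
  have compl: "(\<Sum>i\<in>S. g i) + (\<Sum>i | i \<notin> S. g i) = (\<Sum>i\<in>UNIV. g i)" for S and g :: "'n \<Rightarrow> real"
    using sum.subset_diff[of S UNIV g] by (simp add: Compl_eq_Diff_UNIV[symmetric] Collect_neg_eq add.commute)
  show ?thesis
  proof (cases a)
    case Row
    then have "b \<in> R" using assms by (simp add: R_def)
    then show ?thesis using compl[of "\<lambda>j. W $ b $ j" C] Row
      by (simp add: split C_def add.commute)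
  next
    case Col
    then have "b \<in> C" using assms by (simp add: C_def)
    then show ?thesis using compl[of "\<lambda>i. W $ i $ b" R] Col
      by (simp add: split R_def)
  qed
qed

text \<open>
  An injective choice \<open>f\<close> along positive entries of the folded matrix is a permutation of \<open>K\<close>. A row
  \<open>i\<close> sent to a column \<open>j\<close> contributes the position \<open>(i, j)\<close>; a line sent to itself contributes a
  positive position on a line outside \<open>K\<close>. The values of \<open>f\<close> at the columns that it sends to rows are
  discarded: each column in \<open>K\<close> is served once because \<open>f\<close> takes it as a value exactly once, either
  at a row or at the column itself.
\<close>

lemma diagonal_of_nearly_normalized:
  fixes W :: "real ^ 'n ^ 'n::finite"
  assumes W: "nonneg_matrix W"
    and near: "\<And>a b. (a, b) \<in> K \<Longrightarrow> \<bar>line_sum a b W - 1\<bar> \<le> e"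
    and e: "0 \<le> e" "2 * real (card K) * e < 1"
  shows "\<exists>D. is_diagonal K D \<and> positive_on W D"
proof -
  let ?M = "fold_matrix K W"
  have nonneg: "0 \<le> ?M x y" for x y
    using W by (cases "(K, W, x, y)" rule: fold_matrix.cases) (auto simp: nonneg_matrix_def intro!: sum_nonneg)
  have "\<exists>f. inj_on f K \<and> (\<forall>x\<in>K. f x \<in> K \<and> 0 < ?M x (f x))"
  proof (rule nearly_stochastic_injective_choice[OF finite_lines nonneg _ _ e])
    fix x assume "x \<in> K"
    then have s: "\<bar>(\<Sum>y\<in>K. ?M x y) - 1\<bar> \<le> e"
      using near by (cases x) (simp add: fold_matrix_sum)
    then show "1 - e \<le> (\<Sum>y\<in>K. ?M x y)" by linarith
    have "(\<Sum>y\<in>K. ?M y x) = (\<Sum>y\<in>K. ?M x y)" by (intro sum.cong refl fold_matrix_sym)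
    with s show "(\<Sum>y\<in>K. ?M y x) \<le> 1 + e" by linarith
  qed
  then obtain f where inj: "inj_on f K" and f: "\<And>x. x \<in> K \<Longrightarrow> f x \<in> K \<and> 0 < ?M x (f x)" by blast
  have "f ` K = K" using f inj by (intro endo_inj_surj finite_lines) auto
  then have surj: "\<exists>x\<in>K. f x = y" if "y \<in> K" for y using that by (metis imageE)

  have row_exit: "\<exists>j. (Col, j) \<notin> K \<and> 0 < W $ i $ j" if "(Row, i) \<in> K" "f (Row, i) = (Row, i')" for i i'
  proof (rule ccontr)
    assume no: "\<not> ?thesis"
    have "(\<Sum>j | (Col, j) \<notin> K. W $ i $ j) \<le> 0" using no by (intro sum_nonpos) (auto simp: not_less)
    then show False using f[OF that(1)] that(2) by (auto split: if_splits)
  qed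
  have col_exit: "\<exists>i. (Row, i) \<notin> K \<and> 0 < W $ i $ j" if "(Col, j) \<in> K" "f (Col, j) = (Col, j')" for j j'
  proof (rule ccontr)
    assume no: "\<not> ?thesis"
    have "(\<Sum>i | (Row, i) \<notin> K. W $ i $ j) \<le> 0" using no by (intro sum_nonpos) (auto simp: not_less)
    then show False using f[OF that(1)] that(2) by (auto split: if_splits)
  qed
  define h where "h i = (SOME j. (Col, j) \<notin> K \<and> 0 < W $ i $ j)" for i
  define g where "g j = (SOME i. (Row, i) \<notin> K \<and> 0 < W $ i $ j)" for j
  have h: "(Col, h i) \<notin> K" "0 < W $ i $ h i" if "(Row, i) \<in> K" "f (Row, i) = (Row, i')" for i i'
    using someI_ex[OF row_exit[OF that]] unfolding h_def by auto
  have g: "(Row, g j) \<notin> K" "0 < W $ g j $ j" if "(Col, j) \<in> K" "f (Col, j) = (Col, j')" for j j'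
    using someI_ex[OF col_exit[OF that]] unfolding g_def by auto
  \<comment> \<open>The folded matrix vanishes between two different parallel lines.\<close>
  have same: "f (Row, i) = (Row, i') \<Longrightarrow> (Row, i) \<in> K \<Longrightarrow> i' = i"
    "f (Col, j) = (Col, j') \<Longrightarrow> (Col, j) \<in> K \<Longrightarrow> j' = j" for i i' j j'
    using f[of "(Row, i)"] f[of "(Col, j)"] by (auto split: if_splits)

  define D where "D = {(i, j). (Row, i) \<in> K \<and> f (Row, i) = (Col, j)}
    \<union> {(i, j). (Row, i) \<in> K \<and> f (Row, i) = (Row, i) \<and> j = h i}
    \<union> {(i, j). (Col, j) \<in> K \<and> f (Col, j) = (Col, j) \<and> i = g j}"
  have rows: "\<exists>!p. p \<in> D \<and> fst p = i" if i: "(Row, i) \<in> K" for i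
  proof (cases "f (Row, i)")
    case (Pair a j)
    show ?thesis
    proof (cases a)
      case Row
      then have fi: "f (Row, i) = (Row, i)" using Pair same(1)[of i j] i by simp
      have "p = (i, h i)" if "p \<in> D" "fst p = i" for p
        using that fi i g(1) by (cases p) (auto simp: D_def)
      moreover have "(i, h i) \<in> D" using fi i by (auto simp: D_def)
      ultimately show ?thesis by (metis fst_conv)
    next
      case Col
      then have fi: "f (Row, i) = (Col, j)" using Pair by simp
      have "p = (i, j)" if "p \<in> D" "fst p = i" for p
        using that fi i g(1) by (cases p) (auto simp: D_def)
      moreover have "(i, j) \<in> D" using fi i by (auto simp: D_def)
      ultimately show ?thesis by (metis fst_conv)
    qed
  qed
  have cols: "\<exists>!p. p \<in> D \<and> snd p = j" if j: "(Col, j) \<in> K" for j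
  proof -
    obtain x where x: "x \<in> K" "f x = (Col, j)" using surj[OF j] by blast
    show ?thesis
    proof (cases "fst x")
      case Row
      then obtain i where i: "x = (Row, i)" by (cases x) auto
      have "f (Col, j) \<noteq> (Col, j)"
        using inj_onD[OF inj, of x "(Col, j)"] x j i by auto
      moreover have "i' = i" if "(Row, i') \<in> K" "f (Row, i') = (Col, j)" for i'
        using inj_onD[OF inj, of x "(Row, i')"] x that i by auto
      ultimately have "p = (i, j)" if "p \<in> D" "snd p = j" for p
        using that j h(1) by (cases p) (auto simp: D_def)
      moreover have "(i, j) \<in> D" using x i by (auto simp: D_def)
      ultimately show ?thesis by (metis snd_conv)
    next
      case Col
      then have fj: "f (Col, j) = (Col, j)" using x same(2)[of "snd x" j] by (cases x) auto
      then have "f (Row, i) \<noteq> (Col, j)" if "(Row, i) \<in> K" for i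
        using inj_onD[OF inj, of "(Row, i)" "(Col, j)"] j that by auto
      then have "p = (g j, j)" if "p \<in> D" "snd p = j" for p
        using that j h(1) by (cases p) (auto simp: D_def)
      moreover have "(g j, j) \<in> D" using fj j by (auto simp: D_def)
      ultimately show ?thesis by (metis snd_conv)
    qed
  qed
  have "positive_on W D"
  proof -
    have "0 < W $ i $ j" if "(Row, i) \<in> K" "f (Row, i) = (Col, j)" for i j
      using f[OF that(1)] that(2) by simp
    then show ?thesis using h(2) g(2) by (auto simp: positive_on_def D_def)
  qed
  moreover have "is_diagonal K D"
    unfolding is_diagonal_def by (intro conjI allI impI rows cols)
  ultimately show ?thesis by blast
qed

section \<open>Diagonals and convergence of the line sums\<close>

theorem theorem3p4:
  fixes W0 :: "real ^ 'n ^ 'n::finite"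
    and k :: "nat \<Rightarrow> line_kind"
    and l :: "nat \<Rightarrow> 'n"
  assumes "nonneg_matrix W0"
    and "no_null_lines W0"
  shows "(\<exists>D. is_diagonal (recurrent_lines k l) D \<and> positive_on W0 D) \<longleftrightarrow>
    (\<forall>(a, b)\<in>recurrent_lines k l.
       (\<lambda>t. line_excess a b (normalized_seq k l W0 t)) \<longlonglongrightarrow> 0)"
proof
  assume "\<exists>D. is_diagonal (recurrent_lines k l) D \<and> positive_on W0 D"
  then obtain D where D: "is_diagonal (recurrent_lines k l) D" "positive_on W0 D" by blast
  have "(\<lambda>t. line_excess a b (normalized_seq k l W0 t)) \<longlonglongrightarrow> 0"
    if "(a, b) \<in> recurrent_lines k l" for a b
    using line_sums_converge[OF assms D that] unfolding line_excess_def by (rule LIM_zero)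
  then show "\<forall>(a, b)\<in>recurrent_lines k l.
      (\<lambda>t. line_excess a b (normalized_seq k l W0 t)) \<longlonglongrightarrow> 0" by blast
next
  assume lim: "\<forall>(a, b)\<in>recurrent_lines k l.
      (\<lambda>t. line_excess a b (normalized_seq k l W0 t)) \<longlonglongrightarrow> 0"
  let ?K = "recurrent_lines k l" and ?W = "normalized_seq k l W0"
  \<comment> \<open>Small enough for the counting argument on \<open>card ?K\<close> lines.\<close>
  define e where "e = 1 / (2 * real (card ?K) + 1)"
  have e: "0 < e" "2 * real (card ?K) * e < 1" by (auto simp: e_def field_simps)
  have "\<forall>\<^sub>F t in sequentially. \<forall>x\<in>?K. \<bar>line_sum (fst x) (snd x) (?W t) - 1\<bar> < e"
  proof (rule eventually_ball_finite[OF finite_lines], rule ballI)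
    fix x assume "x \<in> ?K"
    with lim have "(\<lambda>t. line_sum (fst x) (snd x) (?W t) - 1) \<longlonglongrightarrow> 0"
      unfolding line_excess_def by (cases x) auto
    from tendstoD[OF this e(1)] show "\<forall>\<^sub>F t in sequentially. \<bar>line_sum (fst x) (snd x) (?W t) - 1\<bar> < e"
      by simp
  qed
  then obtain t where t: "\<And>x. x \<in> ?K \<Longrightarrow> \<bar>line_sum (fst x) (snd x) (?W t) - 1\<bar> < e"
    using eventually_happens'[OF sequentially_bot] by blast
  have "nonneg_matrix (?W t)"
    using normalized_seq_support[OF assms, of k l t] by (force simp: nonneg_matrix_def entry_def)
  then have "\<exists>D. is_diagonal ?K D \<and> positive_on (?W t) D"
    using t e by (intro diagonal_of_nearly_normalized[of _ _ e]) (force intro: less_imp_le)+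
  moreover have "positive_on (?W t) D \<longleftrightarrow> positive_on W0 D" for D
    using normalized_seq_support[OF assms, of k l t] by (force simp: positive_on_def entry_def)
  ultimately show "\<exists>D. is_diagonal ?K D \<and> positive_on W0 D" by simp
qed

end
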